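(* Suppose that $X$ is a real Banach space of dimension bigger than $1$. Then the following equalities and inequalities hold: (i) $\mathfrak{add}(X)=\omega_1$; (ii) $\omega_1\leq\mathfrak{cov}(X)\leq\mathfrak{c}$; (iii) $\operatorname{dens}(X)\leq\mathfrak{non}(X)\leq \operatorname{cf}([\operatorname{dens}(X)]^\omega)$; (iv) $\mathfrak{cof}(X)=|X^*|$.
   Context: A hyperplane of a Banach space $X$ is a one-codimensional closed linear subspace of $X$. Let $\mathcal{H}_\sigma(X)$ be the family of all subsets of $X$ that can be covered by countably many hyperplanes of $X$. Then: $\mathfrak{add}(X)$ is the minimal cardinality of a family of sets from $\mathcal{H}_\sigma(X)$ whose union is not in $\mathcal{H}_\sigma(X)$; $\mathfrak{cov}(X)$ is the minimal cardinality of a family of sets from $\mathcal{H}_\sigma(X)$ whose union is equal to $X$; $\mathfrak{non}(X)$ is the minimal cardinality of a subset of $X$ that is not in $\mathcal{H}_\sigma(X)$; $\mathfrak{cof}(X)$ is the minimal cardinality of a family of sets from $\mathcal{H}_\sigma(X)$ such that each member of $\mathcal{H}_\sigma(X)$ is contained in some element of that family. $\operatorname{dens}(X)$ is the minimal cardinality of a norm-dense subset of $X$; $X^*$ is the space of bounded linear functionals on $X$; $\mathfrak{c}=|\mathbb{R}|$; $\omega_1$ is the first uncountable cardinal. For a set (cardinal) $A$, $[A]^\omega$ is the set of countable subsets of $A$, and $\operatorname{cf}([A]^\omega)$ is the minimal cardinality of a family of countable subsets of $A$ such that every countable subset of $A$ is included in an element of the family.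
   Formalization: In (iii), the bound non(X) ≤ cf([dens(X)]^ω) is stated only for nonseparable X; for separable X it is replaced by non(X) ≤ ω_1, because with the given definition cf([ω]^ω)=1 while non(X) ≥ ω_1, so the literal inequality fails. *)

theory Defs
  imports "HOL-Analysis.Analysis"
begin

unbundle cardinal_syntax

text \<open>Codimension one means that the quotient by \<open>H\<close> is a line, i.e. that it is spanned by the
  class of a single vector outside \<open>H\<close>.\<close>

definition hyperplane :: "'a::real_normed_vector set \<Rightarrow> bool" where
  "hyperplane H \<longleftrightarrow> subspace H \<and> closed H \<and> (\<exists>v. v \<notin> H \<and> span (insert v H) = UNIV)"

definition H_sigma :: "'a::real_normed_vector set set" where
  "H_sigma = {A. \<exists>\<H>. countable \<H> \<and> (\<forall>H\<in>\<H>. hyperplane H) \<and> A \<subseteq> \<Union>\<H>}"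

text \<open>The least cardinality of a set satisfying \<open>P\<close>, represented by the cardinal
  of a set that attains it. The value is only meaningful if some set satisfies \<open>P\<close>.\<close>

definition min_card :: "('b set \<Rightarrow> bool) \<Rightarrow> 'b rel" where
  "min_card P = |SOME S. P S \<and> (\<forall>T. P T \<longrightarrow> |S| \<le>o |T| )|"

lemma min_card_attained:
  assumes "P T"
  shows "\<exists>S. P S \<and> min_card P = |S| \<and> (\<forall>T. P T \<longrightarrow> |S| \<le>o |T| )"
proof -
  have "\<exists>r\<in>card_of ` Collect P. \<forall>r'\<in>card_of ` Collect P. r \<le>o r'"
    using assms by (intro exists_minim_Card_order) (auto simp: card_of_Card_order)
  then have "\<exists>S. P S \<and> (\<forall>T. P T \<longrightarrow> |S| \<le>o |T| )"
    by auto
  from someI_ex[OF this] show ?thesis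
    unfolding min_card_def by blast
qed

definition add_card :: "'a::real_normed_vector itself \<Rightarrow> 'a set rel" where
  "add_card X = min_card (\<lambda>\<F>. \<F> \<subseteq> H_sigma \<and> \<Union>\<F> \<notin> H_sigma)"

definition cov_card :: "'a::real_normed_vector itself \<Rightarrow> 'a set rel" where
  "cov_card X = min_card (\<lambda>\<F>. \<F> \<subseteq> H_sigma \<and> \<Union>\<F> = UNIV)"

definition non_card :: "'a::real_normed_vector itself \<Rightarrow> 'a rel" where
  "non_card X = min_card (\<lambda>A. A \<notin> H_sigma)"

definition cof_card :: "'a::real_normed_vector itself \<Rightarrow> 'a set rel" where
  "cof_card X = min_card (\<lambda>\<F>. \<F> \<subseteq> H_sigma \<and> (\<forall>A\<in>H_sigma. \<exists>B\<in>\<F>. A \<subseteq> B))"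

definition dens :: "'a::real_normed_vector itself \<Rightarrow> 'a rel" where
  "dens X = min_card (\<lambda>D. closure D = UNIV)"

text \<open>The cofinality of the countable subsets of a set \<open>A\<close>, ordered by inclusion. A cardinal \<open>\<kappa>\<close>
  is a well-order, and the underlying set is \<open>Field \<kappa>\<close>. For countable \<open>A\<close> the family
  \<open>{A}\<close> is cofinal, so the value is 1 and not an uncountable cardinal.\<close>

definition cf_countable :: "'b set \<Rightarrow> 'b set rel" where
  "cf_countable A = min_card (\<lambda>\<F>. (\<forall>C\<in>\<F>. C \<subseteq> A \<and> countable C) \<and>
     (\<forall>C. C \<subseteq> A \<and> countable C \<longrightarrow> (\<exists>D\<in>\<F>. C \<subseteq> D)))"

abbreviation omega1 :: "nat set rel" where
  "omega1 \<equiv> cardSuc natLeq"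

abbreviation continuum :: "real rel" where
  "continuum \<equiv> |UNIV|"

end

theory Submission
  imports Defs "HOL-Complex_Analysis.Conformal_Mappings" "HOL-Library.Countable_Set_Type"
begin

text \<open>
  Closed hyperplanes are the kernels of nonzero bounded functionals (\<open>hyperplane_iff_ker\<close>), so a set is in
  \<open>H_sigma\<close> iff countably many nonzero functionals have the property that each point of the set is a zero of one
  of them. Four ideas carry the proof.

  The first is a curve in general position (\<open>generic_curve\<close>). For a sequence \<open>e\<close>, a functional turns the curve
  \<open>\<Sum>n. t ^ Suc n *\<^sub>R e n\<close> into a power series in \<open>t\<close>, so that it vanishes at only countably many points of the
  curve unless it vanishes at every \<open>e n\<close>. Hence a hyperplane covered by countably many hyperplanes is one of
  them (\<open>ker_covered_imp_mem\<close>), and the space itself is not covered by countably many hyperplanes. Moreover,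
  the points of the curve at \<open>omega1\<close> parameters are never covered by countably many hyperplanes none of which contains
  all \<open>e n\<close>. Placing
  \<open>omega1\<close> such points on the curve of each member of a cofinal family of countable subsets of a dense set gives the upper
  bounds on \<open>non\<close> (\<open>non_card_ordLeq_Times\<close>).

  The second is the Hahn-Banach theorem in the form of \<open>hyperplane_avoiding\<close>. It shows that a set outside \<open>H_sigma\<close>
  spans a dense subspace, which gives \<open>dens \<le> non\<close>, and that there are two independent functionals \<open>f\<close> and \<open>g\<close>
  if the dimension is at least 2.

  The third is the pencil of the hyperplanes \<open>ker g\<close> and \<open>ker (f + t *\<^sub>R g)\<close> for real \<open>t\<close>. It covers the space, so
  \<open>cov\<close> is at most the continuum; and any \<open>omega1\<close> of its members have a union outside \<open>H_sigma\<close>, so \<open>add\<close> is at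
  most \<open>omega1\<close>. The opposite bounds hold because \<open>H_sigma\<close> is closed under countable unions.

  The fourth concerns \<open>cof\<close>. Each set in \<open>H_sigma\<close> contains only countably many hyperplanes, so a cofinal family is
  at least as large as the dual space. Conversely the countable unions of hyperplanes form a cofinal family that is coded by
  sequences in the dual space, and a Banach space has no more sequences than points (\<open>card_of_sequences_banach\<close>).
\<close>

section \<open>Closed hyperplanes and bounded functionals\<close>

lemma subspace_closure:
  fixes N :: "'a::real_normed_vector set"
  assumes "subspace N"
  shows "subspace (closure N)"
proof (rule subspaceI)
  show "0 \<in> closure N"
    using assms closure_subset subspace_0 by blast
  fix x y assume "x \<in> closure N" "y \<in> closure N"
  then obtain a b where "\<And>n. a n \<in> N" "\<And>n. b n \<in> N" "a \<longlonglongrightarrow> x" "b \<longlonglongrightarrow> y"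
    unfolding closure_sequential by blast
  then show "x + y \<in> closure N"
    unfolding closure_sequential
    by (intro exI[of _ "\<lambda>n. a n + b n"]) (auto intro: tendsto_add subspace_add[OF assms])
next
  fix c :: real and x assume "x \<in> closure N"
  then obtain a where "\<And>n. a n \<in> N" "a \<longlonglongrightarrow> x"
    unfolding closure_sequential by blast
  then show "c *\<^sub>R x \<in> closure N"
    unfolding closure_sequential
    by (intro exI[of _ "\<lambda>n. c *\<^sub>R a n"]) (auto intro: tendsto_scaleR subspace_scale[OF assms])
qed

text \<open>This is the geometric Hahn-Banach theorem for a ball and a subspace. A subspace \<open>N \<supseteq> M\<close>
  that is maximal among those missing a ball around \<open>v\<close> is closed, because its closure misses the
  open ball too. It has two disjoint open sides, and together they are everything outside \<open>N\<close>; a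
  connectedness argument then shows that \<open>N\<close> and \<open>v\<close> span the space.\<close>

lemma hyperplane_avoiding:
  fixes M :: "'a::real_normed_vector set"
  assumes M: "subspace M" "closed M" and v: "v \<notin> M"
  shows "\<exists>H. hyperplane H \<and> M \<subseteq> H \<and> v \<notin> H"
proof -
  obtain d where d: "d > 0" "ball v d \<inter> M = {}"
    using M(2) v by (metis Compl_disjoint2 Int_commute closed_def ComplI disjoint_eq_subset_Compl open_contains_ball)
  define C where "C = ball v d"
  have C: "open C" "convex C" "v \<in> C"
    using d by (auto simp: C_def)
  define \<A> where "\<A> = {N. subspace N \<and> M \<subseteq> N \<and> N \<inter> C = {}}"
  have "\<exists>N\<in>\<A>. \<forall>X\<in>\<A>. N \<subseteq> X \<longrightarrow> X = N"
  proof (rule subset_Zorn_nonempty)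
    show "\<A> \<noteq> {}"
      using M d by (auto simp: \<A>_def C_def)
    fix \<C> assume ne: "\<C> \<noteq> {}" and ch: "subset.chain \<A> \<C>"
    then have sub: "\<And>N. N \<in> \<C> \<Longrightarrow> subspace N \<and> M \<subseteq> N \<and> N \<inter> C = {}"
      by (auto simp: subset.chain_def \<A>_def)
    have "subspace (\<Union>\<C>)"
    proof (rule subspaceI)
      show "0 \<in> \<Union>\<C>"
        using ne sub by (auto intro: subspace_0)
      fix x y assume "x \<in> \<Union>\<C>" "y \<in> \<Union>\<C>"
      then obtain N where "N \<in> \<C>" "x \<in> N" "y \<in> N"
        using ch by (auto simp: subset_chain_def) (metis subsetD)
      then show "x + y \<in> \<Union>\<C>"
        using sub by (meson UnionI subspace_add)
    next
      fix c :: real and x assume "x \<in> \<Union>\<C>"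
      then show "c *\<^sub>R x \<in> \<Union>\<C>"
        using sub by (meson UnionE UnionI subspace_scale)
    qed
    then show "\<Union>\<C> \<in> \<A>"
      using ne sub by (fastforce simp: \<A>_def)
  qed
  \<comment> \<open>A subspace maximal among those missing \<open>C\<close> turns out to be the hyperplane.\<close>
  then obtain N where N: "subspace N" "M \<subseteq> N" "N \<inter> C = {}"
    and max: "\<And>X. subspace X \<Longrightarrow> N \<subseteq> X \<Longrightarrow> X \<inter> C = {} \<Longrightarrow> X = N"
    unfolding \<A>_def by (metis (mono_tags, lifting) mem_Collect_eq order_trans)
  have "closure N \<inter> C = {}"
    using N(3) C(1) by (metis Int_commute open_Int_closure_eq_empty)
  then have "closure N = N"
    using N(1) by (intro max) (auto simp: closure_subset subspace_closure)
  then have "closed N"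
    by (metis closed_closure)
  have vN: "v \<notin> N"
    using N(3) C(3) by auto
  \<comment> \<open>One of the two sides of \<open>N\<close>: the sum of \<open>N\<close> and the open cone over \<open>C\<close>.\<close>
  define E where "E = (\<Union>n\<in>N. \<Union>l\<in>{0<..}. (\<lambda>x. n + x) ` ((\<lambda>x. l *\<^sub>R x) ` C))"
  have EI: "n + l *\<^sub>R c \<in> E" if "n \<in> N" "l > 0" "c \<in> C" for n l c
    using that by (auto simp: E_def)
  have EE: "\<exists>n\<in>N. \<exists>l>0. \<exists>c\<in>C. x = n + l *\<^sub>R c" if "x \<in> E" for x
    using that by (auto simp: E_def)
  have oE: "open E"
    unfolding E_def using C(1) by (intro open_UN ballI open_translation open_scaling) auto
  then have oE': "open (uminus ` E)"
    by (rule open_negations)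
  \<comment> \<open>A common point would put a convex combination of two points of \<open>C\<close> into \<open>N\<close>.\<close>
  have disj: "E \<inter> uminus ` E = {}"
  proof (rule ccontr)
    assume "E \<inter> uminus ` E \<noteq> {}"
    then obtain x where "x \<in> E" "- x \<in> E"
      by auto
    then obtain n l c n' l' c' where *: "n \<in> N" "n' \<in> N" "l > 0" "l' > 0" "c \<in> C" "c' \<in> C"
      "x = n + l *\<^sub>R c" "- x = n' + l' *\<^sub>R c'"
      by (metis EE)
    have "l *\<^sub>R c + l' *\<^sub>R c' = - (n + n')"
      using *(7,8) by (metis (no_types, lifting) add.assoc add.commute add.left_commute eq_neg_iff_add_eq_0)
    then have "l *\<^sub>R c + l' *\<^sub>R c' \<in> N"
      using * N(1) by (simp add: subspace_add subspace_diff subspace_neg)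
    then have "(1 / (l + l')) *\<^sub>R (l *\<^sub>R c + l' *\<^sub>R c') \<in> N"
      using N(1) by (simp add: subspace_scale)
    moreover have "(1 / (l + l')) *\<^sub>R (l *\<^sub>R c + l' *\<^sub>R c') = (l / (l + l')) *\<^sub>R c + (l' / (l + l')) *\<^sub>R c'"
      by (simp add: scaleR_right_distrib)
    moreover have "(l / (l + l')) *\<^sub>R c + (l' / (l + l')) *\<^sub>R c' \<in> C"
      using * by (intro convexD[OF C(2)]) (auto simp: add_divide_distrib[symmetric])
    ultimately show False
      using N(3) by auto
  qed
  \<comment> \<open>A point \<open>x\<close> on neither side and not in \<open>N\<close> could be adjoined to \<open>N\<close>.\<close>
  have cover: "x \<in> N \<or> x \<in> E \<or> x \<in> uminus ` E" for x
  proof (rule ccontr)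
    assume x: "\<not> ?thesis"
    have "span (insert x N) \<inter> C = {}"
    proof (rule ccontr)
      assume "span (insert x N) \<inter> C \<noteq> {}"
      then obtain c k where c: "c \<in> C" "c - k *\<^sub>R x \<in> N"
        by (metis IntE N(1) ex_in_conv span_breakdown_eq span_eq_iff)
      have n: "k *\<^sub>R x - c \<in> N"
        using subspace_neg[OF N(1) c(2)] by simp
      consider "k = 0" | "k > 0" | "k < 0" by linarith
      then show False
      proof cases
        case 1 then show ?thesis using c N(3) by auto
      next
        case 2
        have "(1/k) *\<^sub>R (k *\<^sub>R x - c) + (1/k) *\<^sub>R c \<in> E"
          using 2 c(1) n N(1) by (intro EI subspace_scale) auto
        also have "(1/k) *\<^sub>R (k *\<^sub>R x - c) + (1/k) *\<^sub>R c = x"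
          using 2 by (simp add: scaleR_right_diff_distrib)
        finally show ?thesis using x by simp
      next
        case 3
        have "(1 / - k) *\<^sub>R (k *\<^sub>R x - c) + (1 / - k) *\<^sub>R c \<in> E"
          using 3 c(1) n N(1) by (intro EI subspace_scale) auto
        also have "(1 / - k) *\<^sub>R (k *\<^sub>R x - c) + (1 / - k) *\<^sub>R c = - x"
          using 3 by (simp add: scaleR_right_diff_distrib)
        finally show ?thesis using x by (metis image_eqI minus_minus)
      qed
    qed
    then have "span (insert x N) = N"
      by (intro max) (auto simp: span_base subspace_span)
    then show False
      using x by (metis insertI1 span_base)
  qed
  have vE: "v \<in> E"
    using EI[of 0 1 v] N(1) C(3) by (simp add: subspace_0)
  \<comment> \<open>The segment from \<open>v\<close> to the opposite side must cross \<open>N\<close>, as the sides are open and disjoint.\<close>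
  have neg: "x \<in> span (insert v N)" if xE: "x \<in> uminus ` E" for x
  proof -
    have "\<exists>y\<in>closed_segment v x. y \<in> N"
    proof (rule ccontr)
      assume "\<not> ?thesis"
      then have "closed_segment v x \<subseteq> E \<union> uminus ` E"
        using cover by blast
      then have "E \<inter> closed_segment v x = {} \<or> uminus ` E \<inter> closed_segment v x = {}"
        using oE oE' disj by (intro connectedD[OF connected_segment(1)]) auto
      then show False
        using vE xE by auto
    qed
    then obtain s where s: "(1 - s) *\<^sub>R v + s *\<^sub>R x \<in> N"
      by (auto simp: in_segment)
    have "s \<noteq> 0"
      using s vN by auto
    have "(1/s) *\<^sub>R (((1 - s) *\<^sub>R v + s *\<^sub>R x) - (1 - s) *\<^sub>R v) \<in> span (insert v N)"
      using s by (intro span_scale span_diff) (auto intro: span_base)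
    then show ?thesis
      using \<open>s \<noteq> 0\<close> by simp
  qed
  have "x \<in> span (insert v N)" for x
  proof -
    consider "x \<in> N" | "x \<in> E" | "x \<in> uminus ` E"
      using cover by blast
    then show ?thesis
    proof cases
      case 2
      then have "- x \<in> span (insert v N)"
        by (intro neg) auto
      then show ?thesis
        using span_neg by fastforce
    qed (auto intro: neg span_base)
  qed
  then have "hyperplane N"
    unfolding hyperplane_def using N(1) \<open>closed N\<close> vN by auto
  then show ?thesis
    using N(2) vN by auto
qed

abbreviation ker :: "('a::real_normed_vector \<Rightarrow>\<^sub>L real) \<Rightarrow> 'a set" where
  "ker f \<equiv> {x. blinfun_apply f x = 0}"

lemma subspace_ker: "subspace (ker f)"
  by (simp add: subspace_def blinfun.add_right blinfun.scaleR_right)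

lemma closed_ker: "closed (ker f)"
  by (intro closed_Collect_eq) (auto intro: continuous_intros)

lemma blinfun_nonzeroE:
  assumes "(f :: 'a::real_normed_vector \<Rightarrow>\<^sub>L real) \<noteq> 0"
  obtains v where "blinfun_apply f v = 1"
proof -
  obtain w where "blinfun_apply f w \<noteq> 0"
    using assms by (metis blinfun_eqI blinfun.zero_left)
  then have "blinfun_apply f ((1 / blinfun_apply f w) *\<^sub>R w) = 1"
    by (simp add: blinfun.scaleR_right)
  then show ?thesis
    by (rule that)
qed

text \<open>Along a vector \<open>v\<close> outside \<open>H\<close>, every point has a unique coordinate modulo
  \<open>H\<close>. This coordinate is a linear functional with kernel \<open>H\<close>, bounded by the inverse
  of the distance from \<open>v\<close> to \<open>H\<close>.\<close>

lemma hyperplane_iff_ker: "hyperplane H \<longleftrightarrow> (\<exists>f. f \<noteq> 0 \<and> H = ker f)"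
proof
  assume "hyperplane H"
  then obtain v where H: "subspace H" "closed H" "v \<notin> H" "span (insert v H) = UNIV"
    unfolding hyperplane_def by auto
  have ex: "\<exists>k. x - k *\<^sub>R v \<in> H" for x
    using H(1,4) by (metis UNIV_I span_breakdown_eq span_eq_iff)
  define c where "c x = (SOME k. x - k *\<^sub>R v \<in> H)" for x
  have c: "x - c x *\<^sub>R v \<in> H" for x
    unfolding c_def by (rule someI_ex[OF ex])
  have uniq: "c x = k" if "x - k *\<^sub>R v \<in> H" for x k
  proof (rule ccontr)
    assume "c x \<noteq> k"
    have "(x - k *\<^sub>R v) - (x - c x *\<^sub>R v) \<in> H"
      using that c H(1) by (rule subspace_diff[rotated])
    then have "(c x - k) *\<^sub>R v \<in> H"
      by (simp add: algebra_simps)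
    then have "(1 / (c x - k)) *\<^sub>R ((c x - k) *\<^sub>R v) \<in> H"
      using H(1) by (simp only: subspace_scale)
    then show False
      using \<open>c x \<noteq> k\<close> H(3) by simp
  qed
  obtain d where d: "d > 0" "ball v d \<inter> H = {}"
    using H(2,3) by (metis Compl_disjoint2 Int_commute closed_def ComplI disjoint_eq_subset_Compl open_contains_ball)
  have bd: "\<bar>c x\<bar> \<le> norm x * (1 / d)" for x
  proof (cases "c x = 0")
    case False
    \<comment> \<open>The point \<open>v - x / c x\<close> of \<open>H\<close> has distance at least \<open>d\<close> from \<open>v\<close>.\<close>
    have "(- 1 / c x) *\<^sub>R (x - c x *\<^sub>R v) \<in> H"
      using c H(1) by (simp only: subspace_scale)
    then have "v - (1 / c x) *\<^sub>R x \<in> H"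
      using False by (simp add: scaleR_right_diff_distrib)
    then have "d \<le> dist v (v - (1 / c x) *\<^sub>R x)"
      using d(2) by (meson disjoint_iff mem_ball not_le)
    then have "d \<le> norm x / \<bar>c x\<bar>"
      by (simp add: dist_norm)
    then show ?thesis
      using False d(1) by (simp add: field_simps)
  qed (use d(1) in auto)
  have "bounded_linear c"
  proof (rule bounded_linear_intro)
    fix x y
    show "c (x + y) = c x + c y"
    proof (rule uniq)
      have "(x - c x *\<^sub>R v) + (y - c y *\<^sub>R v) \<in> H"
        using c H(1) by (simp add: subspace_add)
      then show "x + y - (c x + c y) *\<^sub>R v \<in> H"
        by (simp add: algebra_simps)
    qed
  next
    fix r x
    show "c (r *\<^sub>R x) = r *\<^sub>R c x"
    proof (rule uniq)
      have "r *\<^sub>R (x - c x *\<^sub>R v) \<in> H"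
        using c H(1) by (simp only: subspace_scale)
      then show "r *\<^sub>R x - (r *\<^sub>R c x) *\<^sub>R v \<in> H"
        by (simp add: algebra_simps)
    qed
  next
    show "norm (c x) \<le> norm x * (1 / d)" for x
      using bd by simp
  qed
  then have ap: "blinfun_apply (Blinfun c) = c"
    by (rule bounded_linear_Blinfun_apply)
  have "c v = 1"
    using H(1) by (intro uniq) (simp add: subspace_0)
  then have "Blinfun c \<noteq> 0"
    using ap by (metis blinfun.zero_left zero_neq_one)
  moreover have "x \<in> H \<longleftrightarrow> c x = 0" for x
    using c[of x] uniq[of x 0] by auto
  then have "H = ker (Blinfun c)"
    by (auto simp: ap)
  ultimately show "\<exists>f. f \<noteq> 0 \<and> H = ker f"
    by blast
next
  assume "\<exists>f. f \<noteq> 0 \<and> H = ker f"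
  then obtain f where f: "f \<noteq> 0" "H = ker f"
    by blast
  obtain v where v: "blinfun_apply f v = 1"
    using f(1) by (rule blinfun_nonzeroE)
  have "x \<in> span (insert v H)" for x
  proof -
    have "x - blinfun_apply f x *\<^sub>R v \<in> H"
      by (simp add: f v blinfun.diff_right blinfun.scaleR_right)
    then show ?thesis
      by (metis span_base span_breakdown_eq)
  qed
  then show "hyperplane H"
    unfolding hyperplane_def using v f by (auto simp: subspace_ker closed_ker intro!: exI[of _ v])
qed

lemma ker_subset_imp_scaleR:
  assumes "f \<noteq> 0" "ker f \<subseteq> ker g"
  shows "\<exists>c. g = c *\<^sub>R f"
proof -
  obtain v where v: "blinfun_apply f v = 1"
    using assms(1) by (rule blinfun_nonzeroE)
  have "blinfun_apply g x = blinfun_apply (blinfun_apply g v *\<^sub>R f) x" for x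
  proof -
    have "x - blinfun_apply f x *\<^sub>R v \<in> ker f"
      by (simp add: v blinfun.diff_right blinfun.scaleR_right)
    then have "blinfun_apply g (x - blinfun_apply f x *\<^sub>R v) = 0"
      using assms(2) by auto
    then show ?thesis
      by (simp add: blinfun.diff_right blinfun.scaleR_right blinfun.scaleR_left)
  qed
  then show ?thesis
    by (intro exI[of _ "blinfun_apply g v"] blinfun_eqI)
qed

lemma ker_subset_imp_eq:
  assumes "f \<noteq> 0" "g \<noteq> 0" "ker f \<subseteq> ker g"
  shows "ker f = ker g"
  using ker_subset_imp_scaleR[OF assms(1,3)] assms(2) by (auto simp: blinfun.scaleR_left)

lemma H_sigma_iff_ker:
  "A \<in> H_sigma \<longleftrightarrow> (\<exists>\<Phi>. countable \<Phi> \<and> 0 \<notin> \<Phi> \<and> A \<subseteq> (\<Union>f\<in>\<Phi>. ker f))"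
proof
  assume "A \<in> H_sigma"
  then obtain \<H> where \<H>: "countable \<H>" "\<And>H. H \<in> \<H> \<Longrightarrow> hyperplane H" "A \<subseteq> \<Union>\<H>"
    unfolding H_sigma_def by auto
  then obtain \<phi> where \<phi>: "\<And>H. H \<in> \<H> \<Longrightarrow> \<phi> H \<noteq> 0 \<and> H = ker (\<phi> H)"
    unfolding hyperplane_iff_ker by metis
  have "countable (\<phi> ` \<H>)"
    using \<H>(1) by simp
  moreover have "0 \<notin> \<phi> ` \<H>"
    using \<H>(2) \<phi> by (metis (no_types, lifting) image_iff)
  moreover have "A \<subseteq> (\<Union>f\<in>\<phi> ` \<H>. ker f)"
    using \<H>(3) \<phi> by blast
  ultimately show "\<exists>\<Phi>. countable \<Phi> \<and> 0 \<notin> \<Phi> \<and> A \<subseteq> (\<Union>f\<in>\<Phi>. ker f)"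
    by blast
next
  assume "\<exists>\<Phi>. countable \<Phi> \<and> 0 \<notin> \<Phi> \<and> A \<subseteq> (\<Union>f\<in>\<Phi>. ker f)"
  then obtain \<Phi> where "countable \<Phi>" "0 \<notin> \<Phi>" "A \<subseteq> (\<Union>f\<in>\<Phi>. ker f)"
    by blast
  then show "A \<in> H_sigma"
    unfolding H_sigma_def hyperplane_iff_ker
    by (intro CollectI exI[of _ "ker ` \<Phi>"]) (auto; metis)
qed

lemma H_sigmaE:
  assumes "A \<in> H_sigma"
  obtains \<Phi> where "countable \<Phi>" "0 \<notin> \<Phi>" "A \<subseteq> (\<Union>f\<in>\<Phi>. ker f)"
  using iffD1[OF H_sigma_iff_ker assms] by (elim exE conjE) (rule that)

lemma ker_in_H_sigma: "f \<noteq> 0 \<Longrightarrow> ker f \<in> H_sigma"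
  unfolding H_sigma_iff_ker by (rule exI[of _ "{f}"]) simp

lemma H_sigma_countable_Union:
  assumes "countable \<F>" "\<F> \<subseteq> H_sigma"
  shows "\<Union>\<F> \<in> H_sigma"
proof -
  have "\<forall>A\<in>\<F>. \<exists>\<H>. countable \<H> \<and> (\<forall>H\<in>\<H>. hyperplane H) \<and> A \<subseteq> \<Union>\<H>"
    using assms(2) unfolding H_sigma_def by blast
  then obtain \<H> where \<H>: "\<And>A. A \<in> \<F> \<Longrightarrow> countable (\<H> A) \<and> (\<forall>H\<in>\<H> A. hyperplane H) \<and> A \<subseteq> \<Union>(\<H> A)"
    by metis
  then have "countable (\<Union>A\<in>\<F>. \<H> A)"
    using assms(1) by blast
  moreover have "\<Union>\<F> \<subseteq> \<Union>(\<Union>A\<in>\<F>. \<H> A)"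
  proof (rule Union_least)
    fix A assume A: "A \<in> \<F>"
    then have "A \<subseteq> \<Union>(\<H> A)"
      using \<H> by simp
    also have "\<dots> \<subseteq> \<Union>(\<Union>A\<in>\<F>. \<H> A)"
      using A by (intro Union_mono UN_upper)
    finally show "A \<subseteq> \<Union>(\<Union>A\<in>\<F>. \<H> A)" .
  qed
  moreover have "\<forall>H\<in>(\<Union>A\<in>\<F>. \<H> A). hyperplane H"
    using \<H> by blast
  ultimately show ?thesis
    unfolding H_sigma_def by blast
qed

section \<open>Curves in general position\<close>

text \<open>The bounded coefficients give a holomorphic function on the complex unit disc, and a nonconstant holomorphic
  function on a connected open set has countably many zeros.\<close>

lemma countable_real_zeros_powser:
  fixes a :: "nat \<Rightarrow> real"
  assumes bd: "\<And>n. \<bar>a n\<bar> \<le> K" and a0: "a 0 = 0" and nz: "a m \<noteq> 0"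
  shows "countable {t \<in> {0<..<1}. (\<Sum>n. a n * t ^ n) = 0}"
proof -
  define F :: "complex \<Rightarrow> complex" where "F z = (\<Sum>n. of_real (a n) * z ^ n)" for z
  have sm: "summable (\<lambda>n. of_real (a n) * z ^ n)" if "norm z < 1" for z :: complex
  proof (rule summable_comparison_test')
    show "summable (\<lambda>n. K * norm z ^ n)"
      using that by (intro summable_mult summable_geometric) simp
    show "norm (of_real (a n) * z ^ n) \<le> K * norm z ^ n" if "n \<ge> 0" for n
      using bd[of n] by (simp add: norm_mult norm_power mult_right_mono)
  qed
  then have sums: "(\<lambda>n. of_real (a n) * z ^ n) sums F z" if "norm z < 1" for z
    using that unfolding F_def by (simp add: summable_sums)
  have hol: "F holomorphic_on ball 0 1"
    by (rule power_series_holomorphic[where a = "\<lambda>n. of_real (a n)"]) (use sums in auto)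
  have F0: "F 0 = 0"
    using sums[of 0] by (simp add: a0 sums_iff)
  have "m > 0"
    using a0 nz by (metis neq0_conv)
  obtain s where s: "s > 0" "\<And>z. z \<in> cball 0 s - {0} \<Longrightarrow> F z \<noteq> 0"
    using powser_0_nonzero[of 1 0 "\<lambda>n. of_real (a n)" F m] sums F0 nz \<open>m > 0\<close> by auto
  \<comment> \<open>\<open>F\<close> vanishes at 0, but not at other points near 0.\<close>
  have "\<not> F constant_on ball 0 1"
  proof
    assume "F constant_on ball 0 1"
    then have "F (of_real (min s (1/2))) = F 0"
      unfolding constant_on_def using s(1) by (force simp: min_def)
    then show False
      using s by (simp add: F0)
  qed
  moreover have "fsigma (ball 0 1 :: complex set)"
    unfolding fsigma_Union_compact
    using open_Union_compact_subsets[OF open_ball, of "0 :: complex" 1]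
    by (metis image_subsetI mem_Collect_eq)
  ultimately have "countable {z \<in> ball 0 1. F z = 0}"
    using hol by (intro holomorphic_countable_zeros) auto
  then have "countable {t \<in> {0<..<1}. of_real t \<in> {z \<in> ball 0 1. F z = 0}}"
    by (intro countable_image_inj_Int_vimage[where f = of_real and S = "{0<..<1}", simplified vimage_def Int_def mem_Collect_eq] inj_onI) auto
  moreover have "F (of_real t) = of_real (\<Sum>n. a n * t ^ n)" if "t \<in> {0<..<1}" for t
  proof -
    have "summable (\<lambda>n. a n * t ^ n)"
    proof (rule summable_comparison_test')
      show "summable (\<lambda>n. K * t ^ n)"
        using that by (intro summable_mult summable_geometric) simp
      show "norm (a n * t ^ n) \<le> K * t ^ n" if "n \<ge> 0" for n
        using bd[of n] \<open>t \<in> _\<close> by (simp add: abs_mult mult_right_mono)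
    qed
    from suminf_of_real[OF this, where 'a = complex] show ?thesis
      by (simp add: F_def)
  qed
  ultimately show ?thesis
    by (rule_tac countable_subset) auto
qed

text \<open>The curve is \<open>x t = (\<Sum>n. t ^ Suc n *\<^sub>R e n)\<close>, with \<open>e n\<close> rescaled to norm
  less than 1. A functional \<open>f\<close> turns it into the power series with coefficients
  \<open>f (e n)\<close>, up to positive factors, which is zero at countably many parameters unless
  \<open>f\<close> vanishes at all \<open>e n\<close>. Every uncountable set of points of the curve is therefore
  in general position with respect to all these functionals.\<close>

lemma generic_curve:
  fixes e :: "nat \<Rightarrow> 'a::banach"
  assumes Y: "subspace Y" "closed Y" and e: "range e \<subseteq> Y"
  shows "\<exists>x :: real \<Rightarrow> 'a. (\<forall>t\<in>{0<..<1}. x t \<in> Y) \<and>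
    (\<forall>f :: 'a \<Rightarrow>\<^sub>L real. (\<exists>n. blinfun_apply f (e n) \<noteq> 0) \<longrightarrow>
       countable {t \<in> {0<..<1}. blinfun_apply f (x t) = 0})"
proof -
  \<comment> \<open>Rescaling \<open>e k\<close> makes the series below converge without changing which functionals vanish on
    it; with constant term 0, the resulting power series can be constant only if it is 0.\<close>
  define u where "u n = (case n of 0 \<Rightarrow> 0 | Suc k \<Rightarrow> (1 / (1 + norm (e k))) *\<^sub>R e k)" for n
  have uY: "u n \<in> Y" for n
    using e Y(1) by (cases n) (auto simp: u_def intro!: subspace_0 subspace_scale)
  have norm_u: "norm (u n) \<le> 1" for n
    by (cases n) (auto simp: u_def divide_simps, smt (verit) norm_ge_zero)
  define x where "x t = (\<Sum>n. t ^ n *\<^sub>R u n)" for t :: real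
  have sm: "summable (\<lambda>n. t ^ n *\<^sub>R u n)" if "t \<in> {0<..<1}" for t :: real
  proof (rule summable_comparison_test')
    show "summable (\<lambda>n. t ^ n)"
      using that by (intro summable_geometric) simp
    show "norm (t ^ n *\<^sub>R u n) \<le> t ^ n" if "n \<ge> 0" for n
      using norm_u[of n] \<open>t \<in> _\<close> by (simp add: mult_left_le)
  qed
  show ?thesis
  proof (intro exI[of _ x] conjI ballI allI impI)
    fix t :: real assume t: "t \<in> {0<..<1}"
    show "x t \<in> Y"
      using Y(2)
    proof (rule closed_sequentially)
      show "(\<Sum>n<k. t ^ n *\<^sub>R u n) \<in> Y" for k
        using Y(1) uY by (intro subspace_sum subspace_scale) auto
      show "(\<lambda>k. \<Sum>n<k. t ^ n *\<^sub>R u n) \<longlonglongrightarrow> x t"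
        unfolding x_def using sm[OF t] by (rule summable_LIMSEQ)
    qed
  next
    fix f :: "'a \<Rightarrow>\<^sub>L real" assume "\<exists>n. blinfun_apply f (e n) \<noteq> 0"
    then obtain m where m: "blinfun_apply f (e m) \<noteq> 0" ..
    define a where "a n = blinfun_apply f (u n)" for n
    have fx: "blinfun_apply f (x t) = (\<Sum>n. a n * t ^ n)" if "t \<in> {0<..<1}" for t
      unfolding x_def using bounded_linear.suminf[OF blinfun.bounded_linear_right sm[OF that], of f]
      by (simp add: blinfun.scaleR_right a_def mult.commute)
    have "\<bar>a n\<bar> \<le> norm f" for n
      using norm_blinfun[of f "u n"] mult_left_le[OF norm_u[of n], of "norm f"]
      by (simp add: a_def)
    moreover have "a 0 = 0"
      by (simp add: a_def u_def)
    moreover have "a (Suc m) \<noteq> 0"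
      using m by (simp add: a_def u_def blinfun.scaleR_right add_nonneg_eq_0_iff)
    ultimately have "countable {t \<in> {0<..<1}. (\<Sum>n. a n * t ^ n) = 0}"
      by (rule countable_real_zeros_powser)
    then show "countable {t \<in> {0<..<1}. blinfun_apply f (x t) = 0}"
      using fx by (rule_tac countable_subset) auto
  qed
qed

text \<open>On a curve in general position for a sequence of points where the functionals do not vanish, each functional
  rules out only countably many parameters. This replaces an appeal to the Baire category theorem.\<close>

lemma exists_common_nonzero:
  fixes Y :: "'a::banach set"
  assumes Y: "subspace Y" "closed Y" and "countable \<Phi>"
    and nz: "\<And>f. f \<in> \<Phi> \<Longrightarrow> \<exists>y\<in>Y. blinfun_apply f y \<noteq> 0"
  shows "\<exists>y\<in>Y. \<forall>f\<in>\<Phi>. blinfun_apply f y \<noteq> (0::real)"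
proof (cases "\<Phi> = {}")
  case True
  then show ?thesis using subspace_0[OF Y(1)] by auto
next
  case False
  define e where "e n = (SOME y. y \<in> Y \<and> blinfun_apply (from_nat_into \<Phi> n) y \<noteq> 0)" for n
  have e: "e n \<in> Y \<and> blinfun_apply (from_nat_into \<Phi> n) (e n) \<noteq> 0" for n
    unfolding e_def by (rule someI_ex) (use nz[OF from_nat_into[OF False]] in blast)
  \<comment> \<open>A functional in \<open>\<Phi>\<close> vanishes at countably many parameters of the curve only.\<close>
  have "range e \<subseteq> Y"
    using e by auto
  from generic_curve[OF Y this] obtain x :: "real \<Rightarrow> 'a" where
    "(\<forall>t\<in>{0<..<1}. x t \<in> Y) \<and>
     (\<forall>f :: 'a \<Rightarrow>\<^sub>L real. (\<exists>n. blinfun_apply f (e n) \<noteq> 0) \<longrightarrow>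
         countable {t \<in> {0<..<1}. blinfun_apply f (x t) = 0})" ..
  then have x: "\<And>t. t \<in> {0<..<1} \<Longrightarrow> x t \<in> Y"
    "\<And>f :: 'a \<Rightarrow>\<^sub>L real. \<exists>n. blinfun_apply f (e n) \<noteq> 0 \<Longrightarrow>
         countable {t \<in> {0<..<1}. blinfun_apply f (x t) = 0}"
    by simp_all
  have "countable {t \<in> {0<..<1}. blinfun_apply f (x t) = 0}" if f: "f \<in> \<Phi>" for f
  proof (rule x(2))
    obtain n where "from_nat_into \<Phi> n = f"
      using from_nat_into_surj[OF \<open>countable \<Phi>\<close> f] by blast
    then show "\<exists>n. blinfun_apply f (e n) \<noteq> 0"
      using e[of n] by auto
  qed
  then have "countable (\<Union>f\<in>\<Phi>. {t \<in> {0<..<1}. blinfun_apply f (x t) = 0})"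
    using \<open>countable \<Phi>\<close> by blast
  moreover have "uncountable {0<..<1::real}"
    by (simp add: uncountable_open_interval)
  ultimately have "\<not> {0<..<1} \<subseteq> (\<Union>f\<in>\<Phi>. {t \<in> {0<..<1}. blinfun_apply f (x t) = 0})"
    using countable_subset by blast
  then obtain t where "t \<in> {0<..<1}" "\<forall>f\<in>\<Phi>. blinfun_apply f (x t) \<noteq> 0"
    by blast
  then show ?thesis
    using x(1) by blast
qed

text \<open>Otherwise each \<open>f \<in> \<Phi>\<close> is nonzero somewhere on the closed subspace \<open>ker g\<close>,
  and a point where none of them vanishes is not covered. In consequence, a set in \<open>H_sigma\<close>
  contains only countably many hyperplanes.\<close>

lemma ker_covered_imp_mem:
  fixes g :: "'a::banach \<Rightarrow>\<^sub>L real"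
  assumes "countable \<Phi>" "0 \<notin> \<Phi>" "g \<noteq> 0" "ker g \<subseteq> (\<Union>f\<in>\<Phi>. ker f)"
  shows "\<exists>f\<in>\<Phi>. ker f = ker g"
proof (rule ccontr)
  assume *: "\<not> ?thesis"
  have "\<exists>y\<in>ker g. blinfun_apply f y \<noteq> 0" if "f \<in> \<Phi>" for f
  proof (rule ccontr)
    assume "\<not> (\<exists>y\<in>ker g. blinfun_apply f y \<noteq> 0)"
    then have "ker g \<subseteq> ker f"
      by auto
    moreover have "f \<noteq> 0"
      using that assms(2) by auto
    ultimately have "ker g = ker f"
      using assms(3) by (intro ker_subset_imp_eq)
    then show False
      using that * by auto
  qed
  from exists_common_nonzero[OF subspace_ker closed_ker assms(1) this]
  show False
    using assms(4) by blast
qed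

text \<open>Each of these uncountably many distinct kernels would be one of the countably many covering ones.\<close>

lemma UN_ker_notin_H_sigma:
  fixes h :: "'i \<Rightarrow> 'a::banach \<Rightarrow>\<^sub>L real"
  assumes nz: "\<And>t. t \<in> T \<Longrightarrow> h t \<noteq> 0" and inj: "inj_on (\<lambda>t. ker (h t)) T" and "uncountable T"
  shows "(\<Union>t\<in>T. ker (h t)) \<notin> H_sigma"
proof
  assume "(\<Union>t\<in>T. ker (h t)) \<in> H_sigma"
  then obtain \<Phi> where \<Phi>: "countable \<Phi>" "0 \<notin> \<Phi>" "(\<Union>t\<in>T. ker (h t)) \<subseteq> (\<Union>f\<in>\<Phi>. ker f)"
    by (rule H_sigmaE)
  have "ker (h t) \<in> ker ` \<Phi>" if "t \<in> T" for t
  proof -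
    have "ker (h t) \<subseteq> (\<Union>f\<in>\<Phi>. ker f)"
      using \<Phi>(3) that by blast
    from ker_covered_imp_mem[OF \<Phi>(1,2) nz[OF that] this] show ?thesis
      by (metis image_eqI)
  qed
  then have "(\<lambda>t. ker (h t)) ` T \<subseteq> ker ` \<Phi>"
    by blast
  then have "countable ((\<lambda>t. ker (h t)) ` T)"
    using \<Phi>(1) by (meson countable_image countable_subset)
  then show False
    using inj \<open>uncountable T\<close> by (simp add: countable_image_inj_eq)
qed

lemma UNIV_notin_H_sigma: "UNIV \<notin> (H_sigma :: 'a::banach set set)"
proof
  assume "UNIV \<in> (H_sigma :: 'a::banach set set)"
  then obtain \<Phi> :: "('a \<Rightarrow>\<^sub>L real) set" where \<Phi>: "countable \<Phi>" "0 \<notin> \<Phi>" "UNIV \<subseteq> (\<Union>f\<in>\<Phi>. ker f)"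
    by (rule H_sigmaE)
  have "\<exists>y\<in>UNIV. blinfun_apply f y \<noteq> 0" if "f \<in> \<Phi>" for f
    using \<Phi>(2) that by (metis UNIV_I blinfun_eqI blinfun.zero_left)
  from exists_common_nonzero[OF _ _ \<Phi>(1) this] show False
    using \<Phi>(3) by (auto simp: set_eq_iff)
qed

section \<open>Pencils of hyperplanes\<close>

lemma exists_functional_one:
  assumes "v \<noteq> (0 :: 'a::real_normed_vector)"
  shows "\<exists>f :: 'a \<Rightarrow>\<^sub>L real. blinfun_apply f v = 1"
proof -
  have "subspace {0 :: 'a}"
    by simp
  then obtain H where "hyperplane H" "v \<notin> H"
    using hyperplane_avoiding[of "{0}" v] assms by auto
  then obtain f :: "'a \<Rightarrow>\<^sub>L real" where "blinfun_apply f v \<noteq> 0"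
    unfolding hyperplane_iff_ker by auto
  then have "blinfun_apply ((1 / blinfun_apply f v) *\<^sub>R f) v = 1"
    by (simp add: blinfun.scaleR_left)
  then show ?thesis ..
qed

text \<open>Choose \<open>f\<close> not vanishing at one of two independent vectors, correct the other vector to lie in the
  kernel of \<open>f\<close>, choose \<open>g\<close> not vanishing there, and correct the first vector in turn.\<close>

lemma exists_biorthogonal_pair:
  fixes B :: "'a::real_normed_vector set"
  assumes "independent B" and "infinite B \<or> 1 < card B"
  obtains f g :: "'a \<Rightarrow>\<^sub>L real" and v w where
    "blinfun_apply f v = 1" "blinfun_apply f w = 0"
    "blinfun_apply g v = 0" "blinfun_apply g w = 1"
proof -
  have "\<exists>a\<in>B. \<exists>b\<in>B. a \<noteq> b"
  proof (rule ccontr)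
    assume *: "\<not> ?thesis"
    \<comment> \<open>Otherwise \<open>B\<close> has at most one element.\<close>
    have "B \<subseteq> {SOME x. x \<in> B}"
      using * by (metis someI singletonI subsetI)
    then show False
      using assms(2) card_mono[of "{SOME x. x \<in> B}" B] finite_subset[of B "{SOME x. x \<in> B}"] by auto
  qed
  then obtain a b where ab: "a \<in> B" "b \<in> B" "a \<noteq> b"
    by blast
  have "a \<noteq> 0"
    using ab(1) assms(1) dependent_zero by metis
  then obtain f :: "'a \<Rightarrow>\<^sub>L real" where f: "blinfun_apply f a = 1"
    using exists_functional_one by blast
  define w0 where "w0 = b - blinfun_apply f b *\<^sub>R a"
  have "w0 \<noteq> 0"
  proof
    assume "w0 = 0"
    then have b: "b = blinfun_apply f b *\<^sub>R a"
      unfolding w0_def by (simp only: right_minus_eq)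
    have "blinfun_apply f b *\<^sub>R a \<in> span (B - {b})"
      using ab by (intro span_scale span_base) simp
    then have "b \<in> span (B - {b})"
      using b by metis
    then show False
      using assms(1) ab(2) unfolding dependent_def by blast
  qed
  then obtain g :: "'a \<Rightarrow>\<^sub>L real" where g: "blinfun_apply g w0 = 1"
    using exists_functional_one by blast
  have fw: "blinfun_apply f w0 = 0"
    by (simp add: w0_def blinfun.diff_right blinfun.scaleR_right f)
  show ?thesis
    by (rule that[of f "a - blinfun_apply g a *\<^sub>R w0" w0 g])
      (simp_all add: blinfun.diff_right blinfun.scaleR_right f g fw)
qed

text \<open>For a biorthogonal pair \<open>f\<close>, \<open>g\<close>, the hyperplanes through the codimension-two subspace
  \<open>ker f \<inter> ker g\<close>, namely \<open>ker g\<close> and the kernels of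
  \<open>f + t *\<^sub>R g\<close>, form a family of size continuum that covers the space. It serves to bound
  \<open>add\<close> and \<open>cov\<close> from above and to see that the dual space has at least continuum
  many directions.\<close>

lemma exists_hyperplane_pencil:
  fixes B :: "'a::real_normed_vector set"
  assumes "independent B" and "infinite B \<or> 1 < card B"
  obtains g and h :: "real \<Rightarrow> 'a \<Rightarrow>\<^sub>L real" where
    "g \<noteq> 0" "\<And>t. h t \<noteq> 0" "inj (\<lambda>t. ker (h t))" "\<And>x. x \<in> ker g \<or> (\<exists>t. x \<in> ker (h t))"
proof -
  obtain f g :: "'a \<Rightarrow>\<^sub>L real" and v w where
    vw: "blinfun_apply f v = 1" "blinfun_apply f w = 0"
    "blinfun_apply g v = 0" "blinfun_apply g w = 1"
    by (rule exists_biorthogonal_pair[OF assms])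
  define h where "h t = f + t *\<^sub>R g" for t
  have h: "blinfun_apply (h t) x = blinfun_apply f x + t * blinfun_apply g x" for t x
    by (simp add: h_def blinfun.add_left blinfun.scaleR_left)
  show ?thesis
  proof
    show "g \<noteq> 0"
      using vw(4) by auto
    show "h t \<noteq> 0" for t
      using h[of t v] vw by auto
    show "inj (\<lambda>t. ker (h t))"
    proof (rule injI)
      fix t s assume "ker (h t) = ker (h s)"
      moreover have "w - t *\<^sub>R v \<in> ker (h t)"
        by (simp add: h vw blinfun.diff_right blinfun.scaleR_right)
      ultimately have "w - t *\<^sub>R v \<in> ker (h s)"
        by blast
      then show "t = s"
        by (simp add: h vw blinfun.diff_right blinfun.scaleR_right)
    qed
    show "x \<in> ker g \<or> (\<exists>t. x \<in> ker (h t))" for x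
    proof (cases "blinfun_apply g x = 0")
      case False
      then have "x \<in> ker (h (- blinfun_apply f x / blinfun_apply g x))"
        by (simp add: h)
      then show ?thesis by blast
    qed simp
  qed
qed

section \<open>Sequences in a Banach space\<close>

lemma maximal_separated_subset:
  fixes A :: "'a::metric_space set"
  assumes "\<epsilon> > 0"
  shows "\<exists>S\<subseteq>A. (\<forall>s\<in>S. \<forall>t\<in>S. s \<noteq> t \<longrightarrow> \<epsilon> \<le> dist s t) \<and> (\<forall>a\<in>A. \<exists>s\<in>S. dist a s < \<epsilon>)"
proof -
  define \<A> where "\<A> = {S. S \<subseteq> A \<and> (\<forall>s\<in>S. \<forall>t\<in>S. s \<noteq> t \<longrightarrow> \<epsilon> \<le> dist s t)}"
  have "\<exists>M\<in>\<A>. \<forall>X\<in>\<A>. M \<subseteq> X \<longrightarrow> X = M"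
  proof (rule subset_Zorn')
    fix C assume C: "subset.chain \<A> C"
    have "\<epsilon> \<le> dist s t" if "s \<in> \<Union>C" "t \<in> \<Union>C" "s \<noteq> t" for s t
    proof -
      obtain X Y where "X \<in> C" "s \<in> X" "Y \<in> C" "t \<in> Y"
        using \<open>s \<in> \<Union>C\<close> \<open>t \<in> \<Union>C\<close> by blast
      moreover have "X \<subseteq> Y \<or> Y \<subseteq> X"
        using C \<open>X \<in> C\<close> \<open>Y \<in> C\<close> unfolding subset_chain_def by blast
      ultimately obtain S where "S \<in> C" "s \<in> S" "t \<in> S"
        by blast
      then show ?thesis
        using C \<open>s \<noteq> t\<close> unfolding subset_chain_def \<A>_def by blast
    qed
    moreover have "\<Union>C \<subseteq> A"
      using C by (auto simp: subset_chain_def \<A>_def)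
    ultimately show "\<Union>C \<in> \<A>"
      by (simp add: \<A>_def)
  qed
  then obtain S where S: "S \<in> \<A>" and max: "\<And>X. X \<in> \<A> \<Longrightarrow> S \<subseteq> X \<Longrightarrow> X = S"
    by blast
  have "\<exists>s\<in>S. dist a s < \<epsilon>" if "a \<in> A" for a
  proof (rule ccontr)
    assume far: "\<not> ?thesis"
    then have "insert a S \<in> \<A>"
      using S that by (auto simp: \<A>_def not_less dist_commute)
    then have "a \<in> S"
      using max by blast
    then show False
      using far assms by force
  qed
  then show ?thesis
    using S by (auto simp: \<A>_def)
qed

text \<open>A decoding lemma: if the weights decrease fast enough in relation to the separation of the digits, the sum of a
  series determines its digits, like the digits of a Cantor set. The first differing digit causes a difference
  that the tail cannot cancel.\<close>

lemma separated_series_eq_imp_eq: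
  fixes s s' :: "nat \<Rightarrow> 'b::banach"
  defines "c \<equiv> \<lambda>n. 1 / (4 ^ n * fact n) :: real"
  assumes norm_le: "\<And>n. norm (s n) \<le> 1" "\<And>n. norm (s' n) \<le> 1"
    and sep: "\<And>n. s n \<noteq> s' n \<Longrightarrow> 1 / real (Suc n) \<le> dist (s n) (s' n)"
    and eq: "(\<Sum>n. c n *\<^sub>R s n) = (\<Sum>n. c n *\<^sub>R s' n)"
  shows "s = s'"
proof (rule ccontr)
  assume "s \<noteq> s'"
  then obtain k where "s k \<noteq> s' k"
    by blast
  define i where "i = (LEAST k. s k \<noteq> s' k)"
  have i: "s i \<noteq> s' i"
    unfolding i_def by (rule LeastI) fact
  have less: "s j = s' j" if "j < i" for j
    using not_less_Least[of j "\<lambda>k. s k \<noteq> s' k"] that by (auto simp: i_def)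
  define d where "d n = s n - s' n" for n
  have c_pos: "c n > 0" for n
    by (simp add: c_def)
  \<comment> \<open>Each weight is smaller than \<open>c i / (i + 1)\<close> by a factor 4, geometrically in \<open>j\<close>, so the
    sum of all later terms cannot make up for a difference of \<open>1 / (i + 1)\<close> at index \<open>i\<close>.\<close>
  have c_tail: "c (j + Suc i) \<le> c i / (4 * real (Suc i)) * (1/4) ^ j" for j
  proof (induction j)
    case 0
    then show ?case by (simp add: c_def field_simps)
  next
    case (Suc j)
    have "c (Suc j + Suc i) = c (j + Suc i) * (1/4) * (1 / real (j + Suc (Suc i)))"
      by (simp add: c_def field_simps)
    also have "\<dots> \<le> c (j + Suc i) * (1/4) * 1"
      using c_pos[of "j + Suc i"] by (intro mult_left_mono) (auto simp: field_simps)
    also have "\<dots> \<le> c i / (4 * real (Suc i)) * (1/4) ^ Suc j"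
      using mult_right_mono[OF Suc, of "1/4"] by (simp add: mult_ac)
    finally show ?case .
  qed
  have summ: "summable (\<lambda>n. c n *\<^sub>R x n)" if "\<And>n. norm (x n) \<le> 1" for x :: "nat \<Rightarrow> 'b"
  proof (rule summable_comparison_test')
    show "summable (\<lambda>n. (1/4::real) ^ n)"
      by (intro summable_geometric) simp
    fix n :: nat
    have "c n \<le> (1/4) ^ n"
      by (simp add: c_def field_simps fact_ge_1)
    then show "norm (c n *\<^sub>R x n) \<le> (1/4) ^ n"
      using that[of n] c_pos[of n] mult_mono[of "c n" "(1/4)^n" "norm (x n)" 1] by simp
  qed
  have sd: "summable (\<lambda>n. c n *\<^sub>R d n)"
    using summable_diff[OF summ summ, of s s'] norm_le by (simp add: d_def scaleR_right_diff_distrib)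
  have "(\<Sum>n. c n *\<^sub>R d n) = 0"
    using suminf_diff[OF summ summ, of s s'] norm_le eq by (simp add: d_def scaleR_right_diff_distrib)
  then have "(\<Sum>n. c (n + Suc i) *\<^sub>R d (n + Suc i)) + (\<Sum>n<Suc i. c n *\<^sub>R d n) = 0"
    using suminf_split_initial_segment[OF sd, of "Suc i"] by simp
  moreover have "(\<Sum>n<Suc i. c n *\<^sub>R d n) = c i *\<^sub>R d i"
    using less by (simp add: d_def)
  ultimately have "c i *\<^sub>R d i = - (\<Sum>n. c (n + Suc i) *\<^sub>R d (n + Suc i))"
    by (simp only: add_eq_0_iff)
  then have "norm (c i *\<^sub>R d i) = norm (\<Sum>n. c (n + Suc i) *\<^sub>R d (n + Suc i))"
    by (simp only: norm_minus_cancel)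
  also have "\<dots> \<le> (\<Sum>n. 2 * (c i / (4 * real (Suc i))) * (1/4) ^ n)"
  proof (rule norm_suminf_le)
    show "summable (\<lambda>n. 2 * (c i / (4 * real (Suc i))) * (1/4::real) ^ n)"
      by (intro summable_mult summable_geometric) simp
    fix n
    have "norm (d (n + Suc i)) \<le> 2"
      using norm_triangle_ineq4[of "s (n + Suc i)" "s' (n + Suc i)"] norm_le[of "n + Suc i"]
      by (simp add: d_def)
    then have "norm (c (n + Suc i) *\<^sub>R d (n + Suc i)) \<le> c (n + Suc i) * 2"
      using c_pos[of "n + Suc i"] by simp
    also have "\<dots> \<le> (c i / (4 * real (Suc i)) * (1/4) ^ n) * 2"
      using c_tail[of n] by (intro mult_right_mono) auto
    finally show "norm (c (n + Suc i) *\<^sub>R d (n + Suc i)) \<le> 2 * (c i / (4 * real (Suc i))) * (1/4) ^ n"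
      by (simp add: mult_ac)
  qed
  also have "\<dots> = 2 * (c i / (4 * real (Suc i))) * (4/3)"
    by (subst suminf_mult) (auto simp: suminf_geometric summable_geometric)
  also have "\<dots> < c i * (1 / real (Suc i))"
    using c_pos[of i] by (simp add: field_simps add_pos_nonneg)
  also have "\<dots> \<le> norm (c i *\<^sub>R d i)"
    using sep[OF i] c_pos[of i] mult_left_mono[OF sep[OF i], of "c i"]
    by (simp add: d_def dist_norm)
  finally show False by simp
qed

text \<open>A point of the unit ball is determined by approximations from maximal \<open>1 / (m + 1)\<close>-separated
  subsets \<open>S m\<close> of the ball, so a sequence of points is determined by a doubly indexed sequence of
  elements of these sets. Arranged in a single rapidly convergent series, the latter is coded by one vector.
  This avoids all case distinctions on the cofinality of the density.\<close>

lemma card_of_sequences_banach: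
  "|UNIV :: (nat \<Rightarrow> 'b::banach) set| \<le>o |UNIV :: 'b set|"
proof -
  have "\<exists>S\<subseteq>cball (0::'b) 1. (\<forall>s\<in>S. \<forall>t\<in>S. s \<noteq> t \<longrightarrow> 1 / real (Suc m) \<le> dist s t) \<and>
      (\<forall>a\<in>cball 0 1. \<exists>s\<in>S. dist a s < 1 / real (Suc m))" for m
    by (intro maximal_separated_subset) simp
  then obtain S :: "nat \<Rightarrow> 'b set" where S: "\<And>m. S m \<subseteq> cball 0 1"
    and sep: "\<And>m s t. s \<in> S m \<Longrightarrow> t \<in> S m \<Longrightarrow> s \<noteq> t \<Longrightarrow> 1 / real (Suc m) \<le> dist s t"
    and net: "\<And>m a. a \<in> cball 0 1 \<Longrightarrow> \<exists>s\<in>S m. dist a s < 1 / real (Suc m)"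
    by metis
  \<comment> \<open>A bijection from the space onto its open unit ball.\<close>
  define \<beta> :: "'b \<Rightarrow> 'b" where "\<beta> y = (1 / (1 + norm y)) *\<^sub>R y" for y
  have norm_\<beta>: "norm (\<beta> y) = norm y / (1 + norm y)" for y
    by (simp add: \<beta>_def)
  have \<beta>_ball: "\<beta> y \<in> cball 0 1" for y
    by (simp add: norm_\<beta> add_pos_nonneg divide_le_eq_1_pos)
  have "inj \<beta>"
  proof (rule inj_on_inverseI)
    fix y :: 'b
    have "1 - norm (\<beta> y) = 1 / (1 + norm y)"
      by (simp add: norm_\<beta> add_pos_nonneg field_simps add_nonneg_eq_0_iff)
    then show "(1 / (1 - norm (\<beta> y))) *\<^sub>R \<beta> y = y"
      by (simp add: \<beta>_def add_nonneg_eq_0_iff)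
  qed
  define p where "p m y = (SOME s. s \<in> S m \<and> dist (\<beta> y) s < 1 / real (Suc m))" for m y
  have p: "p m y \<in> S m \<and> dist (\<beta> y) (p m y) < 1 / real (Suc m)" for m y
    unfolding p_def by (rule someI_ex) (use net[OF \<beta>_ball] in blast)
  have p_inj: "y = y'" if "\<And>m. p m y = p m y'" for y y'
  proof -
    have "\<beta> y = \<beta> y'"
    proof (rule ccontr)
      assume "\<beta> y \<noteq> \<beta> y'"
      then obtain m where m: "inverse (real (Suc m)) < dist (\<beta> y) (\<beta> y') / 2"
        using reals_Archimedean[of "dist (\<beta> y) (\<beta> y') / 2"] by auto
      have "dist (\<beta> y) (\<beta> y') \<le> dist (\<beta> y) (p m y) + dist (\<beta> y') (p m y')"
        using that[of m] by (metis dist_triangle2)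
      also have "\<dots> < 2 * inverse (real (Suc m))"
        using p[of m y] p[of m y'] by (simp add: inverse_eq_divide)
      finally show False
        using m by simp
    qed
    then show ?thesis
      using \<open>inj \<beta>\<close> by (simp add: inj_eq)
  qed
  \<comment> \<open>The nets \<open>S m\<close> are listed with infinite repetition: entry \<open>i = prod_encode (n, m)\<close> approximates
    the term \<open>g n\<close> up to \<open>1 / (m + 1)\<close>. As \<open>m \<le> i\<close>, two different entries at \<open>i\<close> are
    \<open>1 / (i + 1)\<close> apart.\<close>
  define \<sigma> where "\<sigma> g i = p (snd (prod_decode i)) (g (fst (prod_decode i)))" for g :: "nat \<Rightarrow> 'b" and i
  define \<Phi> where "\<Phi> g = (\<Sum>i. (1 / (4 ^ i * fact i)) *\<^sub>R \<sigma> g i)" for g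
  have "inj \<Phi>"
  proof (rule injI)
    fix g g' assume eq: "\<Phi> g = \<Phi> g'"
    have "\<sigma> g = \<sigma> g'"
    proof (rule separated_series_eq_imp_eq)
      show "norm (\<sigma> g n) \<le> 1" "norm (\<sigma> g' n) \<le> 1" for n
        using p S by (metis \<sigma>_def mem_cball_0 subsetD)+
      show "1 / real (Suc n) \<le> dist (\<sigma> g n) (\<sigma> g' n)" if "\<sigma> g n \<noteq> \<sigma> g' n" for n
      proof -
        have "snd (prod_decode n) \<le> n"
          using le_prod_encode_2[of "snd (prod_decode n)" "fst (prod_decode n)"] by simp
        then have "1 / real (Suc n) \<le> 1 / real (Suc (snd (prod_decode n)))"
          by (simp add: field_simps)
        also have "\<dots> \<le> dist (\<sigma> g n) (\<sigma> g' n)"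
          using that p unfolding \<sigma>_def by (intro sep) auto
        finally show ?thesis .
      qed
    qed (use eq in \<open>simp add: \<Phi>_def\<close>)
    then have "p m (g n) = p m (g' n)" for m n
      using fun_cong[of "\<sigma> g" "\<sigma> g'" "prod_encode (n, m)"] unfolding \<sigma>_def by simp
    then show "g = g'"
      using p_inj by blast
  qed
  then show ?thesis
    by (intro card_of_ordLeqI[where f = \<Phi>]) auto
qed

section \<open>Cardinal arithmetic\<close>

lemma card_of_countable_ordLeq_infinite:
  assumes "countable C" "infinite A"
  shows "|C| \<le>o |A|"
proof -
  have "|C| \<le>o |UNIV :: nat set|"
    using assms(1) by (simp add: countable_card_of_nat)
  moreover have "|UNIV :: nat set| \<le>o |A|"
    using assms(2) by (simp add: infinite_iff_card_of_nat)
  ultimately show ?thesis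
    by (rule ordLeq_transitive)
qed

lemma card_of_Times_ordLeq_infinite:
  assumes "infinite C" "|A| \<le>o |C|" "|B| \<le>o |C|"
  shows "|A \<times> B| \<le>o |C|"
  using assms by (intro card_of_Times_ordLeq_infinite_Field) (auto simp: Field_card_of card_of_card_order_on)

lemma omega1_ordLeq_iff_uncountable: "omega1 \<le>o |S| \<longleftrightarrow> uncountable S"
proof -
  have "omega1 \<le>o |S| \<longleftrightarrow> natLeq <o |S|"
    using cardSuc_ordLess_ordLeq[OF natLeq_Card_order card_of_Card_order] by blast
  also have "\<dots> \<longleftrightarrow> \<not> |S| \<le>o natLeq"
    using not_ordLeq_iff_ordLess[OF natLeq_Well_order card_of_Well_order] by blast
  finally show ?thesis
    by (simp add: countable_card_le_natLeq)
qed

lemma exists_omega1_subset: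
  assumes "uncountable A"
  obtains T where "T \<subseteq> A" "uncountable T" "|T| =o omega1"
proof -
  have F: "|Field omega1| =o omega1"
    by (intro card_of_Field_ordIso cardSuc_Card_order natLeq_Card_order)
  moreover have "omega1 \<le>o |A|"
    using assms by (simp add: omega1_ordLeq_iff_uncountable)
  ultimately have "|Field omega1| \<le>o |A|"
    by (rule ordIso_ordLeq_trans)
  then have "\<exists>T\<subseteq>A. |Field omega1| =o |T| \<and> |T| \<le>o |A|"
    by (rule iffD1[OF internalize_card_of_ordLeq2])
  then obtain T where T: "T \<subseteq> A" "|Field omega1| =o |T|"
    by blast
  have iso: "|T| =o omega1"
    using ordIso_symmetric[OF T(2)] F by (rule ordIso_transitive)
  then have "omega1 \<le>o |T|"
    by (rule ordIso_imp_ordLeq[OF ordIso_symmetric])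
  then have "uncountable T"
    by (simp only: omega1_ordLeq_iff_uncountable not_False_eq_True)
  from that[OF T(1) this iso] show ?thesis .
qed

lemma min_card_ordLeq:
  assumes "P T"
  shows "min_card P \<le>o |T|"
  using min_card_attained[of P T] assms by auto

lemma min_cardE:
  assumes "P T"
  obtains S where "P S" "min_card P = |S|"
  using min_card_attained[of P T] assms by auto

section \<open>Additivity and covering number\<close>

text \<open>Any \<open>omega1\<close> members of a pencil have a union outside \<open>H_sigma\<close>, while countable
  unions do not lead out of \<open>H_sigma\<close>.\<close>

lemma add_card_eq_omega1:
  fixes B :: "'a::banach set"
  assumes "independent B" and "infinite B \<or> 1 < card B"
  shows "add_card TYPE('a) =o omega1"
proof -
  obtain g and h :: "real \<Rightarrow> 'a \<Rightarrow>\<^sub>L real" where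
    h: "\<And>t. h t \<noteq> 0" "inj (\<lambda>t. ker (h t))"
    by (rule exists_hyperplane_pencil[OF assms]) blast
  obtain T :: "real set" where T: "T \<subseteq> UNIV" "uncountable T" "|T| =o omega1"
    using uncountable_UNIV_real by (rule exists_omega1_subset)
  define \<F> where "\<F> = (\<lambda>t. ker (h t)) ` T"
  have "(\<Union>t\<in>T. ker (h t)) \<notin> H_sigma"
    using h(1) inj_on_subset[OF h(2) T(1)] T(2) by (rule UN_ker_notin_H_sigma)
  then have \<F>: "\<F> \<subseteq> H_sigma \<and> \<Union>\<F> \<notin> H_sigma"
    using h(1) by (auto simp: \<F>_def intro: ker_in_H_sigma)
  have "add_card TYPE('a) \<le>o |\<F>|"
    unfolding add_card_def by (rule min_card_ordLeq) (rule \<F>)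
  also have "|\<F>| \<le>o |T|"
    unfolding \<F>_def by (rule card_of_image)
  also have "|T| \<le>o omega1"
    using T(3) by (rule ordIso_imp_ordLeq)
  finally have le: "add_card TYPE('a) \<le>o omega1" .
  obtain S :: "'a set set" where "S \<subseteq> H_sigma \<and> \<Union>S \<notin> H_sigma" and
    card_S: "add_card TYPE('a) = |S|"
    unfolding add_card_def
    by (rule min_cardE[of "\<lambda>\<F>. \<F> \<subseteq> H_sigma \<and> \<Union>\<F> \<notin> H_sigma", OF \<F>])
  then have S: "S \<subseteq> H_sigma" "\<Union>S \<notin> H_sigma"
    by auto
  have "uncountable S"
    using H_sigma_countable_Union[OF _ S(1)] S(2) by blast
  then have "omega1 \<le>o add_card TYPE('a)"
    unfolding card_S by (simp only: omega1_ordLeq_iff_uncountable not_False_eq_True)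
  then show ?thesis
    using le by (simp add: ordIso_iff_ordLeq)
qed

text \<open>A pencil covers the space, and countably many members of \<open>H_sigma\<close> do not.\<close>

lemma omega1_le_cov_card_le_continuum:
  fixes B :: "'a::banach set"
  assumes "independent B" and "infinite B \<or> 1 < card B"
  shows "omega1 \<le>o cov_card TYPE('a) \<and> cov_card TYPE('a) \<le>o continuum"
proof -
  obtain g and h :: "real \<Rightarrow> 'a \<Rightarrow>\<^sub>L real" where
    h: "g \<noteq> 0" "\<And>t. h t \<noteq> 0" "\<And>x. x \<in> ker g \<or> (\<exists>t. x \<in> ker (h t))"
    by (rule exists_hyperplane_pencil[OF assms]) blast
  define \<F> where "\<F> = range (\<lambda>t. ker g \<union> ker (h t))"
  have "ker g \<union> ker (h t) \<in> H_sigma" for t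
    unfolding H_sigma_iff_ker using h(1,2) by (intro exI[of _ "{g, h t}"]) auto
  moreover have "\<Union>\<F> = UNIV"
    using h(3) unfolding \<F>_def by blast
  ultimately have \<F>: "\<F> \<subseteq> H_sigma \<and> \<Union>\<F> = UNIV"
    unfolding \<F>_def by blast
  have "cov_card TYPE('a) \<le>o |\<F>|"
    unfolding cov_card_def by (rule min_card_ordLeq) (rule \<F>)
  also have "|\<F>| \<le>o continuum"
    unfolding \<F>_def by (rule card_of_image)
  finally have le: "cov_card TYPE('a) \<le>o continuum" .
  obtain S :: "'a set set" where "S \<subseteq> H_sigma \<and> \<Union>S = UNIV" and
    card_S: "cov_card TYPE('a) = |S|"
    unfolding cov_card_def
    by (rule min_cardE[of "\<lambda>\<F>. \<F> \<subseteq> H_sigma \<and> \<Union>\<F> = UNIV", OF \<F>])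
  then have S: "S \<subseteq> H_sigma" "\<Union>S = UNIV"
    by auto
  have "uncountable S"
    using H_sigma_countable_Union[OF _ S(1)] S(2) UNIV_notin_H_sigma by auto
  then have "omega1 \<le>o cov_card TYPE('a)"
    unfolding card_S by (simp only: omega1_ordLeq_iff_uncountable not_False_eq_True)
  then show ?thesis
    using le by blast
qed

section \<open>Uniformity and density\<close>

text \<open>The combinations of elements of \<open>A\<close> with rational coefficients are dense in the span and not more
  numerous than \<open>A\<close>.\<close>

lemma dens_ordLeq_total:
  fixes A :: "'a::real_normed_vector set"
  assumes "infinite A" and total: "closure (span A) = UNIV"
  shows "dens TYPE('a) \<le>o |A|"
proof -
  \<comment> \<open>\<open>D n\<close> consists of the sums of \<open>n\<close> rational multiples of elements of \<open>A\<close>.\<close>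
  define D where "D = rec_nat {0} (\<lambda>_ X. (\<lambda>((q :: real, a), x). x + q *\<^sub>R a) ` ((\<rat> \<times> A) \<times> X))"
  have D_0: "D 0 = {0}"
    and D_Suc: "\<And>n. D (Suc n) = (\<lambda>((q :: real, a), x). x + q *\<^sub>R a) ` ((\<rat> \<times> A) \<times> D n)"
    by (simp_all add: D_def)
  have card_D: "|D n| \<le>o |A|" for n
  proof (induction n)
    case 0
    then show ?case
      using assms(1) by (simp add: D_0 card_of_countable_ordLeq_infinite)
  next
    case (Suc n)
    have "|\<rat> :: real set| \<le>o |A|"
      using countable_rat assms(1) by (rule card_of_countable_ordLeq_infinite)
    then have "|((\<rat> :: real set) \<times> A) \<times> D n| \<le>o |A|"
      using Suc ordIso_imp_ordLeq[OF card_of_refl, of A]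
      by (intro card_of_Times_ordLeq_infinite[OF assms(1)])
    then show ?case
      unfolding D_Suc using card_of_image ordLeq_transitive by blast
  qed
  define E where "E = (\<Union>n. D n)"
  have card_E: "|E| \<le>o |A|"
    unfolding E_def using assms(1) card_D
    by (intro card_of_UNION_ordLeq_infinite card_of_countable_ordLeq_infinite) auto
  have E_0: "0 \<in> E"
    using D_0 unfolding E_def by blast
  have E_step: "q *\<^sub>R a + x \<in> E" if "q \<in> \<rat>" "a \<in> A" "x \<in> E" for q a x
  proof -
    obtain n where "x \<in> D n"
      using \<open>x \<in> E\<close> by (auto simp: E_def)
    then have "x + q *\<^sub>R a \<in> D (Suc n)"
      unfolding D_Suc using that by (intro image_eqI[of _ _ "((q, a), x)"]) auto
    then show ?thesis
      by (auto simp: E_def add.commute)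
  qed
  have "y \<in> closure E" if "y \<in> span A" for y
    using that
  proof (induction rule: span_induct_alt)
    case base
    then show ?case using E_0 closure_subset by blast
  next
    case (step c a y)
    obtain x where x: "\<And>n. x n \<in> E" "x \<longlonglongrightarrow> y"
      using step.IH unfolding closure_sequential by blast
    have "c \<in> closure \<rat>"
      by (simp add: Rats_closure_real)
    then obtain q where q: "\<And>n. q n \<in> \<rat>" "q \<longlonglongrightarrow> c"
      unfolding closure_sequential by blast
    have "(\<lambda>n. q n *\<^sub>R a + x n) \<longlonglongrightarrow> c *\<^sub>R a + y"
      using x(2) q(2) by (intro tendsto_intros)
    moreover have "q n *\<^sub>R a + x n \<in> E" for n
      using q(1) x(1) step.hyps by (intro E_step)
    ultimately show ?case
      unfolding closure_sequential by (intro exI[of _ "\<lambda>n. q n *\<^sub>R a + x n"]) auto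
  qed
  then have "closure (span A) \<subseteq> closure E"
    by (intro closure_minimal) auto
  then have "closure E = UNIV"
    using total by auto
  then have "dens TYPE('a) \<le>o |E|"
    unfolding dens_def by (rule min_card_ordLeq)
  then show ?thesis
    using card_E ordLeq_transitive by blast
qed

text \<open>A set outside \<open>H_sigma\<close> has dense span, as otherwise a single hyperplane would contain it.\<close>

lemma dens_le_non_card:
  fixes B :: "'a::banach set"
  assumes "independent B" and "infinite B \<or> 1 < card B"
  shows "dens TYPE('a) \<le>o non_card TYPE('a)"
proof -
  obtain g and h :: "real \<Rightarrow> 'a \<Rightarrow>\<^sub>L real" where
    h: "g \<noteq> 0" "\<And>t. h t \<noteq> 0" "\<And>x. x \<in> ker g \<or> (\<exists>t. x \<in> ker (h t))"
    by (rule exists_hyperplane_pencil[OF assms]) blast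
  obtain A :: "'a set" where A: "A \<notin> H_sigma" "non_card TYPE('a) = |A|"
    unfolding non_card_def
    by (rule min_cardE[of "\<lambda>A. A \<notin> H_sigma", OF UNIV_notin_H_sigma])
  \<comment> \<open>This is where dimension at least 2 enters: for a line, \<open>{0}\<close> is the only hyperplane.\<close>
  have pt: "{x} \<in> H_sigma" for x :: 'a
    unfolding H_sigma_iff_ker using h(3)[of x]
  proof
    assume "x \<in> ker g"
    then show "\<exists>\<Phi>. countable \<Phi> \<and> 0 \<notin> \<Phi> \<and> {x} \<subseteq> (\<Union>f\<in>\<Phi>. ker f)"
      using h(1) by (intro exI[of _ "{g}"]) auto
  next
    assume "\<exists>t. x \<in> ker (h t)"
    then obtain t where "x \<in> ker (h t)" ..
    then show "\<exists>\<Phi>. countable \<Phi> \<and> 0 \<notin> \<Phi> \<and> {x} \<subseteq> (\<Union>f\<in>\<Phi>. ker f)"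
      using h(2)[of t] by (intro exI[of _ "{h t}"]) auto
  qed
  have "infinite A"
  proof
    assume "finite A"
    then have "\<Union>((\<lambda>x. {x}) ` A) \<in> H_sigma"
      using pt by (intro H_sigma_countable_Union) (auto intro: countable_finite)
    then show False
      using A(1) by simp
  qed
  moreover have "closure (span A) = UNIV"
  proof (rule ccontr)
    assume "closure (span A) \<noteq> UNIV"
    then obtain v where "v \<notin> closure (span A)"
      by blast
    then obtain H where H: "hyperplane H" "closure (span A) \<subseteq> H"
      using hyperplane_avoiding[of "closure (span A)" v] subspace_closure[OF subspace_span] by blast
    have "A \<subseteq> H"
      using H(2) closure_subset[of "span A"] span_superset[of A] by blast
    then have "A \<in> H_sigma"
      unfolding H_sigma_def using H(1) by (intro CollectI exI[of _ "{H}"]) auto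
    then show False
      using A(1) by simp
  qed
  ultimately show ?thesis
    unfolding A(2) by (rule dens_ordLeq_total)
qed

text \<open>For each \<open>C \<in> \<C>\<close> take a generic curve for an enumeration of \<open>C\<close>, and let
  \<open>A\<close> consist of the points of these curves with parameter in \<open>T\<close>. Countably many
  nonzero functionals are each nonzero somewhere on \<open>D\<close>; these countably many witnesses lie in one
  \<open>C\<close>, and all but countably many points of its curve avoid all the kernels.\<close>

lemma non_card_ordLeq_Times:
  fixes D :: "'a::banach set"
  assumes D: "closure D = UNIV"
    and \<C>: "\<And>C. C \<in> \<C> \<Longrightarrow> countable C"
    and cofinal: "\<And>C. C \<subseteq> D \<Longrightarrow> countable C \<Longrightarrow> \<exists>C'\<in>\<C>. C \<subseteq> C'"
    and T: "T \<subseteq> {0<..<1::real}" "uncountable T"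
  shows "non_card TYPE('a) \<le>o |\<C> \<times> T|"
proof -
  have "\<exists>x :: real \<Rightarrow> 'a. \<forall>f :: 'a \<Rightarrow>\<^sub>L real. (\<exists>y\<in>C. blinfun_apply f y \<noteq> 0) \<longrightarrow>
       countable {t \<in> {0<..<1}. blinfun_apply f (x t) = 0}" if C: "C \<in> \<C>" for C
  proof (cases "C = {}")
    case False
    have e: "range (from_nat_into C) = C"
      using False \<C>[OF C] by (rule range_from_nat_into)
    obtain x :: "real \<Rightarrow> 'a" where x: "(\<forall>t\<in>{0<..<1}. x t \<in> UNIV) \<and>
      (\<forall>f :: 'a \<Rightarrow>\<^sub>L real. (\<exists>n. blinfun_apply f (from_nat_into C n) \<noteq> 0) \<longrightarrow>
         countable {t \<in> {0<..<1}. blinfun_apply f (x t) = 0})"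
      using generic_curve[OF subspace_UNIV closed_UNIV subset_UNIV, of "from_nat_into C"] ..
    have "\<exists>n. blinfun_apply f (from_nat_into C n) \<noteq> 0"
      if "\<exists>y\<in>C. blinfun_apply f y \<noteq> 0" for f :: "'a \<Rightarrow>\<^sub>L real"
      using that from_nat_into_surj[OF \<C>[OF C]] by metis
    then show ?thesis
      using x by (intro exI[of _ x]) simp
  qed simp
  then obtain x :: "'a set \<Rightarrow> real \<Rightarrow> 'a" where
    x: "\<And>C f. C \<in> \<C> \<Longrightarrow> \<exists>y\<in>C. blinfun_apply f y \<noteq> (0::real) \<Longrightarrow>
       countable {t \<in> {0<..<1}. blinfun_apply f (x C t) = 0}"
    by metis
  define A where "A = (\<lambda>(C, t). x C t) ` (\<C> \<times> T)"
  have "A \<notin> H_sigma"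
  proof
    assume "A \<in> H_sigma"
    then obtain \<Phi> where \<Phi>: "countable \<Phi>" "0 \<notin> \<Phi>" "A \<subseteq> (\<Union>f\<in>\<Phi>. ker f)"
      unfolding H_sigma_iff_ker by blast
    have "\<exists>y\<in>D. blinfun_apply f y \<noteq> 0" if "f \<in> \<Phi>" for f
    proof (rule ccontr)
      assume "\<not> ?thesis"
      then have "closure D \<subseteq> ker f"
        by (intro closure_minimal closed_ker) auto
      then have "f = 0"
        using D by (auto intro!: blinfun_eqI)
      then show False
        using that \<Phi>(2) by simp
    qed
    then obtain d where d: "\<And>f. f \<in> \<Phi> \<Longrightarrow> d f \<in> D \<and> blinfun_apply f (d f) \<noteq> 0"
      by metis
    then obtain C where C: "C \<in> \<C>" "d ` \<Phi> \<subseteq> C"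
      using cofinal[of "d ` \<Phi>"] \<Phi>(1) by auto
    have "countable (\<Union>f\<in>\<Phi>. {t \<in> {0<..<1}. blinfun_apply f (x C t) = 0})"
    proof (intro countable_UN \<Phi>(1) x C(1))
      show "\<exists>y\<in>C. blinfun_apply f y \<noteq> 0" if "f \<in> \<Phi>" for f
        using d[OF that] C(2) that by blast
    qed
    moreover have "T \<subseteq> (\<Union>f\<in>\<Phi>. {t \<in> {0<..<1}. blinfun_apply f (x C t) = 0})"
    proof
      fix t assume t: "t \<in> T"
      then have "x C t \<in> A"
        using C(1) by (auto simp: A_def)
      then show "t \<in> (\<Union>f\<in>\<Phi>. {t \<in> {0<..<1}. blinfun_apply f (x C t) = 0})"
        using \<Phi>(3) t T(1) by auto
    qed
    ultimately show False
      using T(2) countable_subset by blast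
  qed
  then have "non_card TYPE('a) \<le>o |A|"
    unfolding non_card_def by (rule min_card_ordLeq)
  then show ?thesis
    unfolding A_def using card_of_image ordLeq_transitive by blast
qed

lemma dens_attained:
  obtains D :: "'a::real_normed_vector set" where "closure D = UNIV" "dens TYPE('a) = |D|"
  unfolding dens_def by (rule min_cardE[of "\<lambda>D. closure D = UNIV", OF closure_UNIV])

text \<open>In the separable case, one generic curve for a countable dense set is enough.\<close>

lemma non_card_le_omega1:
  assumes "dens TYPE('a::banach) \<le>o natLeq"
  shows "non_card TYPE('a) \<le>o omega1"
proof -
  obtain D :: "'a set" where D: "closure D = UNIV" "dens TYPE('a) = |D|"
    by (rule dens_attained)
  have "countable D"
    using assms by (simp add: D(2) countable_card_le_natLeq)
  have "uncountable {0<..<1::real}"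
    by (simp add: uncountable_open_interval)
  then obtain T :: "real set" where T: "T \<subseteq> {0<..<1}" "uncountable T" "|T| =o omega1"
    by (rule exists_omega1_subset)
  have "non_card TYPE('a) \<le>o |{D} \<times> T|"
    using D(1) \<open>countable D\<close> T(1,2) by (intro non_card_ordLeq_Times) auto
  also have "|{D} \<times> T| \<le>o |T|"
    by (rule card_of_ordLeqI[of snd]) (auto simp: inj_on_def)
  also have "|T| \<le>o omega1"
    using T(3) by (rule ordIso_imp_ordLeq)
  finally show ?thesis .
qed

text \<open>A cofinal family of countable subsets of an uncountable dense set is itself uncountable, as it covers that set.
  The factor of size \<open>omega1\<close> coming from the parameters on each curve is then absorbed.\<close>

lemma non_card_le_cf_countable:
  assumes "natLeq <o dens TYPE('a::banach)"
  shows "non_card TYPE('a) \<le>o cf_countable (Field (dens TYPE('a)))"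
proof -
  obtain D :: "'a set" where D: "closure D = UNIV" "dens TYPE('a) = |D|"
    by (rule dens_attained)
  let ?P = "\<lambda>\<F>. (\<forall>C\<in>\<F>. C \<subseteq> D \<and> countable C) \<and>
     (\<forall>C. C \<subseteq> D \<and> countable C \<longrightarrow> (\<exists>E\<in>\<F>. C \<subseteq> E))"
  have "?P {C. C \<subseteq> D \<and> countable C}"
    by blast
  then obtain \<C> where \<C>: "?P \<C>" "cf_countable D = |\<C>|"
    unfolding cf_countable_def by (rule min_cardE[of ?P])
  have "uncountable D"
    using assms not_ordLess_ordLeq by (auto simp: D(2) countable_card_le_natLeq)
  have "uncountable \<C>"
  proof
    assume "countable \<C>"
    then have "countable (\<Union>\<C>)"
      using \<C>(1) by (intro countable_UN[of _ "\<lambda>C. C", simplified]) auto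
    moreover have "D \<subseteq> \<Union>\<C>"
    proof
      fix x assume "x \<in> D"
      then have "{x} \<subseteq> D \<and> countable {x}"
        by simp
      then show "x \<in> \<Union>\<C>"
        using \<C>(1) by blast
    qed
    ultimately show False
      using \<open>uncountable D\<close> countable_subset by blast
  qed
  have "uncountable {0<..<1::real}"
    by (simp add: uncountable_open_interval)
  then obtain T :: "real set" where T: "T \<subseteq> {0<..<1}" "uncountable T" "|T| =o omega1"
    by (rule exists_omega1_subset)
  have "omega1 \<le>o |\<C>|"
    using \<open>uncountable \<C>\<close> by (simp only: omega1_ordLeq_iff_uncountable not_False_eq_True)
  then have "|T| \<le>o |\<C>|"
    by (rule ordIso_ordLeq_trans[OF T(3)])
  then have le: "|\<C> \<times> T| \<le>o |\<C>|"
    using \<open>uncountable \<C>\<close> ordIso_imp_ordLeq[OF card_of_refl]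
    by (intro card_of_Times_ordLeq_infinite) (auto intro: countable_finite)
  have "non_card TYPE('a) \<le>o |\<C> \<times> T|"
    using D(1) _ _ T(1,2)
  proof (rule non_card_ordLeq_Times)
    show "countable C" if "C \<in> \<C>" for C
      using \<C>(1) that by blast
    show "\<exists>C'\<in>\<C>. C \<subseteq> C'" if "C \<subseteq> D" "countable C" for C
      using \<C>(1) that by blast
  qed
  also note le
  finally show ?thesis
    by (simp only: D(2) Field_card_of \<C>(2))
qed

section \<open>Cofinality and the dual space\<close>

text \<open>Choose countably many functionals for each member of \<open>S\<close>. Each hyperplane lies in some member of
  \<open>S\<close> and hence is the kernel of a chosen functional, so every functional is a multiple of a chosen
  one. There are at most \<open>|S|\<close> chosen functionals, and the pencil shows that \<open>|S|\<close> is
  at least the continuum, which takes care of the scalars.\<close>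

lemma card_of_dual_le_cofinal:
  fixes B :: "'a::banach set" and S :: "'a set set"
  assumes "independent B" and "infinite B \<or> 1 < card B"
    and S: "S \<subseteq> H_sigma" and cofinal: "\<And>A. A \<in> H_sigma \<Longrightarrow> \<exists>B\<in>S. A \<subseteq> B"
  shows "|UNIV :: ('a \<Rightarrow>\<^sub>L real) set| \<le>o |S|"
proof -
  obtain g and h :: "real \<Rightarrow> 'a \<Rightarrow>\<^sub>L real" where
    h: "\<And>t. h t \<noteq> 0" "inj (\<lambda>t. ker (h t))"
    by (rule exists_hyperplane_pencil[OF assms(1,2)]) blast
  have "\<exists>\<Phi>. countable \<Phi> \<and> 0 \<notin> \<Phi> \<and> A \<subseteq> (\<Union>f\<in>\<Phi>. ker f)" if "A \<in> S" for A
    using S that H_sigma_iff_ker by blast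
  then obtain \<Phi> where \<Phi>: "\<And>A. A \<in> S \<Longrightarrow> countable (\<Phi> A)" "\<And>A. A \<in> S \<Longrightarrow> 0 \<notin> \<Phi> A"
    "\<And>A. A \<in> S \<Longrightarrow> A \<subseteq> (\<Union>f\<in>\<Phi> A. ker f)"
    by metis
  define \<Psi> where "\<Psi> = (\<Union>A\<in>S. \<Phi> A)"
  have \<Psi>: "\<exists>\<phi>\<in>\<Psi>. \<phi> \<noteq> 0 \<and> ker \<phi> = ker f" if f: "f \<noteq> 0" for f
  proof -
    obtain A where A: "A \<in> S" "ker f \<subseteq> A"
      using cofinal[OF ker_in_H_sigma[OF f]] by blast
    have "ker f \<subseteq> (\<Union>f\<in>\<Phi> A. ker f)"
      using A(2) \<Phi>(3)[OF A(1)] by (rule subset_trans)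
    then obtain \<phi> where "\<phi> \<in> \<Phi> A" "ker \<phi> = ker f"
      using ker_covered_imp_mem[OF \<Phi>(1,2)[OF A(1)] f] by blast
    moreover have "\<phi> \<noteq> 0"
      using \<Phi>(2)[OF A(1)] \<open>\<phi> \<in> \<Phi> A\<close> by metis
    ultimately show ?thesis
      unfolding \<Psi>_def using A(1) by blast
  qed
  have range_h: "range (\<lambda>t. ker (h t)) \<subseteq> ker ` \<Psi>"
  proof (rule image_subsetI)
    fix t show "ker (h t) \<in> ker ` \<Psi>"
      using \<Psi>[OF h(1)[of t]] by (metis image_eqI)
  qed
  have "infinite S"
  proof
    assume "finite S"
    then have "countable \<Psi>"
      unfolding \<Psi>_def using \<Phi>(1) by (intro countable_UN countable_finite[OF \<open>finite S\<close>])
    then have "countable (range (\<lambda>t. ker (h t)))"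
      using range_h by (meson countable_image countable_subset)
    then show False
      using h(2) uncountable_UNIV_real by (simp add: countable_image_inj_eq)
  qed
  have card_\<Psi>: "|\<Psi>| \<le>o |S|"
    unfolding \<Psi>_def
  proof (rule card_of_UNION_ordLeq_infinite[OF \<open>infinite S\<close>])
    show "|S| \<le>o |S|"
      by (rule ordIso_imp_ordLeq[OF card_of_refl])
    show "\<forall>A\<in>S. |\<Phi> A| \<le>o |S|"
      using \<Phi>(1) \<open>infinite S\<close> by (blast intro: card_of_countable_ordLeq_infinite)
  qed
  have "|UNIV :: real set| \<le>o |range (\<lambda>t. ker (h t))|"
    using h(2) by (rule card_of_ordLeqI) simp
  also have "|range (\<lambda>t. ker (h t))| \<le>o |\<Psi>|"
    using range_h by (rule surj_imp_ordLeq)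
  also note card_\<Psi>
  finally have "|\<Psi> \<times> (UNIV :: real set)| \<le>o |S|"
    by (intro card_of_Times_ordLeq_infinite \<open>infinite S\<close> card_\<Psi>)
  moreover have "UNIV \<subseteq> (\<lambda>(\<phi>, c). c *\<^sub>R \<phi>) ` (\<Psi> \<times> UNIV)"
  proof
    fix f :: "'a \<Rightarrow>\<^sub>L real"
    have "\<exists>\<phi>\<in>\<Psi>. \<exists>c. f = c *\<^sub>R \<phi>"
    proof (cases "f = 0")
      case True
      then show ?thesis
        using \<Psi>[OF h(1)] by (metis scaleR_zero_left)
    next
      case False
      then show ?thesis
        using \<Psi>[OF False] ker_subset_imp_scaleR by (metis order_refl)
    qed
    then show "f \<in> (\<lambda>(\<phi>, c). c *\<^sub>R \<phi>) ` (\<Psi> \<times> UNIV)"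
      by auto
  qed
  then have "|UNIV :: ('a \<Rightarrow>\<^sub>L real) set| \<le>o |\<Psi> \<times> (UNIV :: real set)|"
    by (rule surj_imp_ordLeq)
  ultimately show ?thesis
    using ordLeq_transitive by blast
qed

text \<open>The upper bound counts sequences of functionals, of which there are no more than functionals because the dual
  space is a Banach space.\<close>

lemma cof_card_eq_card_dual:
  fixes B :: "'a::banach set"
  assumes "independent B" and "infinite B \<or> 1 < card B"
  shows "cof_card TYPE('a) =o |UNIV :: ('a \<Rightarrow>\<^sub>L real) set|"
proof -
  \<comment> \<open>Terms equal to 0 are skipped, so that every sequence of functionals codes a countable union
    of hyperplanes and finite or empty unions need no separate treatment.\<close>
  define U where "U \<phi> = (\<Union>n\<in>{n. \<phi> n \<noteq> 0}. ker (\<phi> n))" for \<phi> :: "nat \<Rightarrow> 'a \<Rightarrow>\<^sub>L real"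
  have "U \<phi> \<in> H_sigma" for \<phi>
    unfolding H_sigma_iff_ker U_def by (rule exI[of _ "\<phi> ` {n. \<phi> n \<noteq> 0}"]) auto
  moreover have "\<exists>B\<in>range U. A \<subseteq> B" if A: "A \<in> H_sigma" for A
  proof -
    obtain \<Phi> where \<Phi>: "countable \<Phi>" "0 \<notin> \<Phi>" "A \<subseteq> (\<Union>f\<in>\<Phi>. ker f)"
      using A by (rule H_sigmaE)
    \<comment> \<open>Inserting 0, which \<open>U\<close> ignores, makes the set nonempty and thus enumerable.\<close>
    define \<phi> where "\<phi> = from_nat_into (insert 0 \<Phi>)"
    have "ker f \<subseteq> U \<phi>" if f: "f \<in> \<Phi>" for f
    proof -
      obtain n where n: "\<phi> n = f"
        unfolding \<phi>_def using from_nat_into_surj[of "insert 0 \<Phi>" f] f \<Phi>(1) by auto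
      moreover have "f \<noteq> 0"
        using f \<Phi>(2) by auto
      ultimately have "ker (\<phi> n) \<subseteq> U \<phi>"
        unfolding U_def by (intro UN_upper) simp
      then show ?thesis
        by (simp only: n)
    qed
    then have "(\<Union>f\<in>\<Phi>. ker f) \<subseteq> U \<phi>"
      by (rule UN_least)
    then have "A \<subseteq> U \<phi>"
      using \<Phi>(3) by (rule subset_trans[rotated])
    then show ?thesis
      by (rule bexI) simp
  qed
  ultimately have U: "range U \<subseteq> H_sigma \<and> (\<forall>A\<in>H_sigma. \<exists>B\<in>range U. A \<subseteq> B)"
    by (intro conjI ballI image_subsetI)
  have "cof_card TYPE('a) \<le>o |range U|"
    unfolding cof_card_def by (rule min_card_ordLeq) (rule U)
  also have "|range U| \<le>o |UNIV :: (nat \<Rightarrow> 'a \<Rightarrow>\<^sub>L real) set|"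
    by (rule card_of_image)
  also have "|UNIV :: (nat \<Rightarrow> 'a \<Rightarrow>\<^sub>L real) set| \<le>o |UNIV :: ('a \<Rightarrow>\<^sub>L real) set|"
    by (rule card_of_sequences_banach)
  finally have le: "cof_card TYPE('a) \<le>o |UNIV :: ('a \<Rightarrow>\<^sub>L real) set|" .
  obtain S :: "'a set set" where "S \<subseteq> H_sigma \<and> (\<forall>A\<in>H_sigma. \<exists>B\<in>S. A \<subseteq> B)" and
    card_S: "cof_card TYPE('a) = |S|"
    unfolding cof_card_def
    by (rule min_cardE[of "\<lambda>\<F>. \<F> \<subseteq> H_sigma \<and> (\<forall>A\<in>H_sigma. \<exists>B\<in>\<F>. A \<subseteq> B)", OF U])
  then have S: "S \<subseteq> H_sigma" "\<forall>A\<in>H_sigma. \<exists>B\<in>S. A \<subseteq> B"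
    by auto
  have "|UNIV :: ('a \<Rightarrow>\<^sub>L real) set| \<le>o |S|"
    using S(2) by (intro card_of_dual_le_cofinal[OF assms S(1)]) blast
  then show ?thesis
    using le unfolding card_S by (simp add: ordIso_iff_ordLeq)
qed

section \<open>The cardinal invariants of a Banach space\<close>

theorem theorem2:
  fixes B :: "'a::banach set"
  assumes "independent B" and "span B = UNIV" and "infinite B \<or> 1 < card B"
  shows
    "add_card TYPE('a) =o omega1 \<and>
     (omega1 \<le>o cov_card TYPE('a) \<and> cov_card TYPE('a) \<le>o continuum) \<and>
     (dens TYPE('a) \<le>o non_card TYPE('a) \<and>
      (natLeq <o dens TYPE('a) \<longrightarrow>
        non_card TYPE('a) \<le>o cf_countable (Field (dens TYPE('a)))) \<and>
      (dens TYPE('a) \<le>o natLeq \<longrightarrow> non_card TYPE('a) \<le>o omega1)) \<and>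
     cof_card TYPE('a) =o |UNIV :: ('a \<Rightarrow>\<^sub>L real) set|"
  using add_card_eq_omega1[OF assms(1,3)] omega1_le_cov_card_le_continuum[OF assms(1,3)]
    dens_le_non_card[OF assms(1,3)] non_card_le_cf_countable non_card_le_omega1
    cof_card_eq_card_dual[OF assms(1,3)]
  by blast

end
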